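(* Let $p$ be an odd prime and $a\in\mathbb{Z}_p$. Then, modulo $p^3$, the polynomial $$(a+1)P_{p-1}(a+1,x)-(2a+1)xP_{p-1}(a,x)+aP_{p-1}(a-1,x)$$ is congruent to $$\begin{cases} -2p^2\left(\dfrac 1{\langle a\rangle_p}+\dfrac 1{\langle a\rangle_p+1}\right)\dfrac{a-\langle a\rangle_p}p\left(1+\dfrac{a-\langle a\rangle_p}p\right)\left(\dfrac{x-1}2\right)^p &\text{if } a\not\equiv 0,-1\pmod p,\\[2mm] -2a(p+a+1)\left(\dfrac{x-1}2\right)^p &\text{if } a\equiv 0\pmod p,\\[2mm] 2(a+1)(a-p)\left(\dfrac{x-1}2\right)^p&\text{if } a\equiv -1\pmod p.\end{cases}$$
   Context: $\mathbb{Z}_p$ denotes the set of rational $p$-integers, i.e. rational numbers whose denominator is not divisible by $p$. For $a\in\mathbb{Z}_p$, $\langle a\rangle_p\in\{0,1,\ldots,p-1\}$ is the least nonnegative residue of $a$ modulo $p$. $\binom ak=a(a-1)\cdots(a-k+1)/k!$ (with $\binom a0=1$). The generalized Legendre polynomial is $$P_n(a,x)=\sum_{k=0}^n\binom ak\binom{-1-a}k\left(\frac{1-x}2\right)^k .$$ Here $x$ is a variable; a congruence modulo $p^3$ between polynomials in $x$ with coefficients in $\mathbb{Z}_p$ means that all coefficients of the difference lie in $p^3\mathbb{Z}_p$ (in particular it holds for every value $x\in\mathbb{Z}_p$). *)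

theory Defs
  imports "HOL-Computational_Algebra.Computational_Algebra"
begin

definition p_integers :: "nat \<Rightarrow> rat set" where
  "p_integers p = {a. \<not> int p dvd snd (quotient_of a)}"

text \<open>Congruence modulo \<open>m\<close> in the ring of rational \<open>p\<close>-integers, i.e. \<open>a - b\<close> lies in
  \<open>m\<close> times that ring. The library's \<open>[a = b] (mod m)\<close> is no substitute: on the field
  \<^typ>\<open>rat\<close> it is trivial for nonzero \<open>m\<close>.\<close>

definition rat_pcong :: "nat \<Rightarrow> nat \<Rightarrow> rat \<Rightarrow> rat \<Rightarrow> bool" where
  "rat_pcong p m a b \<longleftrightarrow> (\<exists>c\<in>p_integers p. a - b = of_nat m * c)"

definition poly_pcong :: "nat \<Rightarrow> nat \<Rightarrow> rat poly \<Rightarrow> rat poly \<Rightarrow> bool" where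
  "poly_pcong p m f g \<longleftrightarrow> (\<forall>i. \<exists>c\<in>p_integers p. coeff (f - g) i = of_nat m * c)"

definition least_residue :: "nat \<Rightarrow> rat \<Rightarrow> nat" where
  "least_residue p a = (LEAST r. rat_pcong p p a (of_nat r))"

text \<open>The generalized Legendre polynomial, as a polynomial in the variable \<open>x\<close>;
  \<open>[:1/2, -1/2:]\<close> is \<open>(1 - x)/2\<close>.\<close>

definition gen_legendre :: "nat \<Rightarrow> rat \<Rightarrow> rat poly" where
  "gen_legendre n a =
     (\<Sum>k=0..n. smult ((a gchoose k) * ((-1 - a) gchoose k)) ([:1/2, -1/2:] ^ k))"

end

theory Submission
  imports Defs
begin

text \<open>
  Put \<open>y = (1 - x)/2\<close> and \<open>c\<^sub>k(a) = (a choose k) (-1-a choose k)\<close>.  For every \<open>k \<ge> 1\<close> the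
  coefficients satisfy
  \<open>(a+1) c\<^sub>k(a+1) - (2a+1) c\<^sub>k(a) + a c\<^sub>k(a-1) + 2 (2a+1) c\<^bsub>k-1\<^esub>(a) = 0\<close>,
  which is Legendre's three-term recurrence read off in powers of \<open>y\<close>, where multiplication by
  \<open>x = 1 - 2y\<close> shifts the index.  Truncating the series at degree \<open>n\<close> therefore leaves exactly
  one boundary term, \<open>2 (2a+1) c\<^sub>n(a) y\<^bsup>n+1\<^esup>\<close> (lemma \<open>gen_legendre_recurrence_defect\<close>).
  With \<open>n = p - 1\<close> the theorem becomes the determination of the single number
  \<open>(2a+1) c\<^bsub>p-1\<^esub>(a)\<close> modulo \<open>p\<^sup>3\<close>.

  Since \<open>p\<close> is odd, \<open>(-1-a choose p-1) = (a+p-1 choose p-1)\<close>, so \<open>(a-p+1) a c\<^bsub>p-1\<^esub>(a)\<close>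
  is the product of two blocks of \<open>p\<close> consecutive terms, divided by \<open>((p-1)!)\<^sup>2\<close>.
  Each block runs through all residues, so it consists of one multiple of \<open>p\<close> and of factors
  with product congruent to \<open>(p-1)!\<close> (lemma \<open>block_of_consecutive_factors\<close>).

  If \<open>a \<equiv> r\<close> with \<open>r \<noteq> 0, -1\<close>, the two multiples of \<open>p\<close> are \<open>a - r = pt\<close> and
  \<open>a + p - r = p(1+t)\<close>; they provide \<open>p\<^sup>2 t (1+t)\<close>, and the cofactor in
  \<open>(2a+1) c\<^bsub>p-1\<^esub>(a)\<close> is needed modulo \<open>p\<close> only, where it is \<open>(2r+1)/(r(r+1)) = 1/r + 1/(r+1)\<close>.
  If \<open>a \<equiv> 0\<close>, the only multiple of \<open>p\<close> is \<open>a\<close> itself, and the rest is needed modulo \<open>p\<^sup>2\<close>.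
  Multiplied by the unit \<open>a - p + 1\<close> it becomes, on pairing \<open>a - j\<close> with \<open>-a - j\<close>, the product
  of the terms \<open>1 - a\<^sup>2/j\<^sup>2 \<equiv> 1\<close> for \<open>0 < j < p\<close>.
  The case \<open>a \<equiv> -1\<close> follows from \<open>a \<equiv> 0\<close> by the symmetry \<open>a \<mapsto> -1-a\<close>, which fixes
  \<open>c\<^sub>k\<close> and changes the sign of \<open>2a+1\<close>.
\<close>

section \<open>Rational \<open>p\<close>-integers\<close>

context
  fixes p :: nat
  assumes prime_p: "prime p"
begin

text \<open>Lowest terms are awkward for closure properties; any denominator prime to \<open>p\<close> will do.\<close>

lemma p_integers_iff:
  "a \<in> p_integers p \<longleftrightarrow> (\<exists>m n. \<not> int p dvd n \<and> a = of_int m / of_int n)"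
proof
  assume "a \<in> p_integers p"
  obtain m n where q: "quotient_of a = (m, n)" by fastforce
  with \<open>a \<in> p_integers p\<close> have "\<not> int p dvd n" by (simp add: p_integers_def)
  with quotient_of_div[OF q] show "\<exists>m n. \<not> int p dvd n \<and> a = of_int m / of_int n" by blast
next
  assume "\<exists>m n. \<not> int p dvd n \<and> a = of_int m / of_int n"
  then obtain m n where n: "\<not> int p dvd n" and a: "a = of_int m / of_int n" by blast
  obtain m' n' where q: "quotient_of a = (m', n')" by fastforce
  have n0: "n \<noteq> 0" using n by auto
  have n'0: "n' > 0" using quotient_of_denom_pos[OF q] .
  have "of_int m / of_int n = (of_int m' / of_int n' :: rat)"
    using a quotient_of_div[OF q] by simp
  then have "of_int (m * n') = (of_int (m' * n) :: rat)"
    using n0 n'0 by (simp add: field_simps)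
  then have "m * n' = m' * n" by (simp only: of_int_eq_iff)
  then have "n' dvd m' * n" by (metis dvd_triv_right)
  moreover have "coprime n' m'" using quotient_of_coprime[OF q] by (simp add: coprime_commute)
  ultimately have "n' dvd n" by (simp add: coprime_dvd_mult_right_iff)
  then have "\<not> int p dvd n'" using n dvd_trans by blast
  then show "a \<in> p_integers p" using q by (simp add: p_integers_def)
qed

lemma int_prime_p: "prime (int p)"
  using prime_p by simp

lemma p_integers_of_int [simp]: "of_int m \<in> p_integers p"
proof -
  have "\<not> int p dvd 1" using int_prime_p not_prime_unit by blast
  then show ?thesis unfolding p_integers_iff by (intro exI[of _ m] exI[of _ 1]) simp
qed

lemma p_integers_of_nat [simp]: "of_nat m \<in> p_integers p"
  using p_integers_of_int[of "int m"] by simp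

lemma p_integers_numeral [simp]:
  "0 \<in> p_integers p" "1 \<in> p_integers p" "numeral k \<in> p_integers p"
  using p_integers_of_int[of 0] p_integers_of_int[of 1] p_integers_of_int[of "numeral k"]
  by simp_all

lemma p_integers_add:
  assumes "a \<in> p_integers p" "b \<in> p_integers p" shows "a + b \<in> p_integers p"
proof -
  from assms obtain m n m' n' where *: "\<not> int p dvd n" "a = of_int m / of_int n"
    "\<not> int p dvd n'" "b = of_int m' / of_int n'" unfolding p_integers_iff by blast
  then have "n \<noteq> 0" "n' \<noteq> 0" by auto
  then have "a + b = of_int (m * n' + m' * n) / of_int (n * n')"
    using * by (simp add: field_simps)
  moreover have "\<not> int p dvd n * n'" using * int_prime_p by (simp add: prime_dvd_mult_iff)
  ultimately show ?thesis unfolding p_integers_iff by blast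
qed

lemma p_integers_mult:
  assumes "a \<in> p_integers p" "b \<in> p_integers p" shows "a * b \<in> p_integers p"
proof -
  from assms obtain m n m' n' where *: "\<not> int p dvd n" "a = of_int m / of_int n"
    "\<not> int p dvd n'" "b = of_int m' / of_int n'" unfolding p_integers_iff by blast
  have "a * b = of_int (m * m') / of_int (n * n')" using * by simp
  moreover have "\<not> int p dvd n * n'" using * int_prime_p by (simp add: prime_dvd_mult_iff)
  ultimately show ?thesis unfolding p_integers_iff by blast
qed

lemma p_integers_minus: "a \<in> p_integers p \<Longrightarrow> - a \<in> p_integers p"
  using p_integers_mult[OF p_integers_of_int[of "-1"]] by simp

lemma p_integers_diff: "a \<in> p_integers p \<Longrightarrow> b \<in> p_integers p \<Longrightarrow> a - b \<in> p_integers p"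
  using p_integers_add[of a "- b"] p_integers_minus[of b] by simp

lemma p_integers_sum: "(\<And>i. i \<in> A \<Longrightarrow> f i \<in> p_integers p) \<Longrightarrow> sum f A \<in> p_integers p"
  by (induction A rule: infinite_finite_induct) (auto intro: p_integers_add)

lemma p_integers_prod: "(\<And>i. i \<in> A \<Longrightarrow> f i \<in> p_integers p) \<Longrightarrow> prod f A \<in> p_integers p"
  by (induction A rule: infinite_finite_induct) (auto intro: p_integers_mult)

lemmas p_integers_closed = p_integers_add p_integers_mult p_integers_minus p_integers_diff

lemma p_integers_inverse:
  assumes "a \<in> p_integers p" "\<not> rat_pcong p p a 0"
  shows "inverse a \<in> p_integers p"
proof -
  from assms(1) obtain m n where *: "\<not> int p dvd n" "a = of_int m / of_int n"
    unfolding p_integers_iff by blast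
  have "\<not> int p dvd m"
  proof
    assume "int p dvd m"
    then obtain k where "m = int p * k" by blast
    then have "a - 0 = of_nat p * (of_int k / of_int n)" using * by simp
    moreover have "of_int k / of_int n \<in> p_integers p" unfolding p_integers_iff using * by blast
    ultimately show False using assms(2) unfolding rat_pcong_def by blast
  qed
  moreover have "inverse a = of_int n / of_int m" using * by simp
  ultimately show ?thesis unfolding p_integers_iff by blast
qed

section \<open>Congruences between rational \<open>p\<close>-integers\<close>

lemma rat_pcong_refl [simp]: "rat_pcong p m a a"
  unfolding rat_pcong_def by (intro bexI[of _ 0]) simp_all

lemma rat_pcong_sym: "rat_pcong p m a b \<Longrightarrow> rat_pcong p m b a"
  unfolding rat_pcong_def using p_integers_minus by (metis minus_diff_eq mult_minus_right)

lemma rat_pcong_trans: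
  assumes "rat_pcong p m a b" "rat_pcong p m b c" shows "rat_pcong p m a c"
proof -
  from assms obtain u v where "u \<in> p_integers p" "v \<in> p_integers p"
    "a - b = of_nat m * u" "b - c = of_nat m * v" unfolding rat_pcong_def by blast
  then have "a - c = of_nat m * (u + v)" "u + v \<in> p_integers p"
    by (simp_all add: algebra_simps p_integers_add)
  then show ?thesis unfolding rat_pcong_def by blast
qed

lemma rat_pcong_add:
  assumes "rat_pcong p m a b" "rat_pcong p m c d" shows "rat_pcong p m (a + c) (b + d)"
proof -
  from assms obtain u v where "u \<in> p_integers p" "v \<in> p_integers p"
    "a - b = of_nat m * u" "c - d = of_nat m * v" unfolding rat_pcong_def by blast
  then have "(a + c) - (b + d) = of_nat m * (u + v)" "u + v \<in> p_integers p"
    by (simp_all add: algebra_simps p_integers_add)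
  then show ?thesis unfolding rat_pcong_def by blast
qed

lemma rat_pcong_mult:
  assumes "rat_pcong p m a b" "rat_pcong p m c d" "a \<in> p_integers p" "d \<in> p_integers p"
  shows "rat_pcong p m (a * c) (b * d)"
proof -
  from assms obtain u v where uv: "u \<in> p_integers p" "v \<in> p_integers p"
    "a - b = of_nat m * u" "c - d = of_nat m * v" unfolding rat_pcong_def by blast
  have "a * c - b * d = a * (c - d) + (a - b) * d" by (simp add: algebra_simps)
  also have "\<dots> = of_nat m * (a * v + u * d)" using uv by (simp add: algebra_simps)
  finally have "a * c - b * d = of_nat m * (a * v + u * d)" .
  moreover have "a * v + u * d \<in> p_integers p" using uv assms by (intro p_integers_closed)
  ultimately show ?thesis unfolding rat_pcong_def by blast
qed

lemma rat_pcong_mult_left: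
  "rat_pcong p m a b \<Longrightarrow> c \<in> p_integers p \<Longrightarrow> rat_pcong p m (c * a) (c * b)"
  unfolding rat_pcong_def
  by (metis mult.left_commute p_integers_mult right_diff_distrib)

lemma rat_pcong_scale_modulus:
  "rat_pcong p m a b \<Longrightarrow> rat_pcong p (n * m) (of_nat n * a) (of_nat n * b)"
  unfolding rat_pcong_def by (auto simp: right_diff_distrib[symmetric] mult.assoc)

lemma rat_pcong_prod:
  assumes "\<And>i. i \<in> A \<Longrightarrow> rat_pcong p m (f i) (g i)"
    and "\<And>i. i \<in> A \<Longrightarrow> f i \<in> p_integers p" and "\<And>i. i \<in> A \<Longrightarrow> g i \<in> p_integers p"
  shows "rat_pcong p m (prod f A) (prod g A)"
  using assms
proof (induction A rule: infinite_finite_induct)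
  case (insert i A)
  then show ?case by (auto intro!: rat_pcong_mult p_integers_prod)
qed auto

lemma rat_pcong_inverse:
  assumes "rat_pcong p m a b" "inverse a \<in> p_integers p" "inverse b \<in> p_integers p"
    and "a \<noteq> 0" "b \<noteq> 0"
  shows "rat_pcong p m (inverse a) (inverse b)"
proof -
  have "rat_pcong p m ((inverse a * inverse b) * b) ((inverse a * inverse b) * a)"
    using assms by (intro rat_pcong_mult_left rat_pcong_sym[OF assms(1)] p_integers_mult)
  moreover have "(inverse a * inverse b) * b = inverse a" "(inverse a * inverse b) * a = inverse b"
    using assms(4,5) by simp_all
  ultimately show ?thesis by simp
qed

lemma rat_pcong_of_nat_mult: "a \<in> p_integers p \<Longrightarrow> rat_pcong p m (of_nat m * a) 0"
  unfolding rat_pcong_def by auto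

lemma rat_pcong_of_nat_0_iff: "rat_pcong p p (of_nat k) 0 \<longleftrightarrow> p dvd k"
proof
  assume "p dvd k"
  then show "rat_pcong p p (of_nat k) 0"
    using p_integers_of_nat rat_pcong_of_nat_mult by (auto elim!: dvdE)
next
  assume "rat_pcong p p (of_nat k) 0"
  then obtain c where "c \<in> p_integers p" "of_nat k = of_nat p * c"
    unfolding rat_pcong_def by auto
  then obtain m n where n: "\<not> int p dvd n" and k: "of_nat k = of_nat p * (of_int m / of_int n :: rat)"
    unfolding p_integers_iff by blast
  have "n \<noteq> 0" using n by auto
  then have "of_int (int k * n) = (of_int (int p * m) :: rat)" using k by (simp add: field_simps)
  then have "int k * n = int p * m" by (simp only: of_int_eq_iff)
  then have "int p dvd int k * n" by simp
  then have "int p dvd int k" using n int_prime_p by (simp add: prime_dvd_mult_iff)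
  then show "p dvd k" by simp
qed

lemma p_integers_inverse_of_nat:
  "\<not> p dvd k \<Longrightarrow> inverse (of_nat k) \<in> p_integers p"
  by (intro p_integers_inverse) (auto simp: rat_pcong_of_nat_0_iff)

lemma p_integers_inverse_fact: "k < p \<Longrightarrow> inverse (fact k) \<in> p_integers p"
  using p_integers_inverse_of_nat[of "fact k"] prime_p by (simp add: prime_dvd_fact_iff)

text \<open>A Bezout relation between \<open>p\<close> and the denominator inverts the latter modulo \<open>p\<close>.\<close>

lemma least_residue:
  assumes "a \<in> p_integers p"
  shows least_residue_less: "least_residue p a < p"
    and rat_pcong_least_residue: "rat_pcong p p a (of_nat (least_residue p a))"
proof -
  from assms obtain m n where n: "\<not> int p dvd n" and a: "a = of_int m / of_int n"
    unfolding p_integers_iff by blast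
  have n0: "n \<noteq> 0" using n by auto
  have "coprime n (int p)"
    using prime_imp_coprime[OF int_prime_p n] by (simp add: coprime_commute)
  then obtain u v where uv: "u * n + v * int p = 1" using bezout_int[of n "int p"] by auto
  define r where "r = nat ((u * m) mod int p)"
  have p0: "p > 0" using prime_p prime_gt_0_nat by blast
  have r: "int r = (u * m) mod int p" "r < p" using p0 by (simp_all add: r_def nat_less_iff)
  have um: "u * m = int p * ((u * m) div int p) + int r" using r by simp
  have "rat_pcong p p a (of_nat r)"
  proof -
    have "of_int (u * n + v * int p) = (1 :: rat)" unfolding uv by simp
    then have uvq: "of_int u * of_int n = 1 - of_int v * (of_nat p :: rat)" by simp
    have "of_int (u * m) = (of_int (int p * ((u * m) div int p) + int r) :: rat)"
      using um by simp
    then have "of_nat r = of_int u * of_int m - of_nat p * (of_int ((u * m) div int p) :: rat)"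
      by simp
    moreover have "a - of_int u * of_int m = of_nat p * (of_int v * a)"
    proof -
      have "a - of_int u * of_int m = a * (1 - of_int u * of_int n)"
        using a n0 by (simp add: field_simps)
      also have "\<dots> = of_nat p * (of_int v * a)" unfolding uvq by (simp add: algebra_simps)
      finally show ?thesis .
    qed
    ultimately have "a - of_nat r = of_nat p * (of_int v * a + of_int ((u * m) div int p))"
      by (simp add: algebra_simps)
    moreover have "of_int v * a + of_int ((u * m) div int p) \<in> p_integers p"
      using assms by (intro p_integers_closed p_integers_of_int)
    ultimately show ?thesis unfolding rat_pcong_def by blast
  qed
  then show "rat_pcong p p a (of_nat (least_residue p a))" "least_residue p a < p"
    unfolding least_residue_def using r(2)
    by (auto intro: LeastI le_less_trans[OF Least_le])
qed

section \<open>Congruences between multiples of a polynomial\<close>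

lemma p_integers_coeff_mult:
  "(\<And>i. coeff f i \<in> p_integers p) \<Longrightarrow> (\<And>i. coeff g i \<in> p_integers p) \<Longrightarrow>
    coeff (f * g) i \<in> p_integers p"
  by (auto simp: coeff_mult intro!: p_integers_sum p_integers_mult)

lemma p_integers_coeff_power:
  "(\<And>i. coeff f i \<in> p_integers p) \<Longrightarrow> coeff (f ^ n) i \<in> p_integers p"
  by (induction n arbitrary: i) (auto simp: coeff_1 intro: p_integers_coeff_mult)

lemma poly_pcong_smult:
  assumes "rat_pcong p m s s'" "\<And>i. coeff f i \<in> p_integers p"
  shows "poly_pcong p m (smult s f) (smult s' f)"
proof -
  from assms(1) obtain c where c: "c \<in> p_integers p" "s - s' = of_nat m * c"
    unfolding rat_pcong_def by blast
  have "coeff (smult s f - smult s' f) i = of_nat m * (c * coeff f i)" for i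
    using c by (simp add: left_diff_distrib[symmetric])
  then show ?thesis unfolding poly_pcong_def using c assms(2) p_integers_mult by blast
qed

end

section \<open>Blocks of consecutive factors\<close>

lemma gbinomial_complete_block:
  fixes b :: "'a :: field_char_0"
  shows "(b - of_nat n) * (b gchoose n) = inverse (fact n) * (\<Prod>j\<in>{0..<Suc n}. b - of_nat j)"
  by (simp add: gbinomial_prod_rev field_simps)

text \<open>The product is \<open>b (b-1) \<dots> (b-p+1) / (p-1)!\<close>.  Its \<open>p\<close> factors run through all residues
  modulo \<open>p\<close>; apart from the multiple \<open>b - r = pt\<close> of \<open>p\<close> they are congruent, in some order, to
  \<open>1, \<dots>, p-1\<close>.\<close>

lemma block_of_consecutive_factors:
  assumes prime_p: "prime p" and "t \<in> p_integers p" "r < p"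
  defines "b \<equiv> of_nat r + of_nat p * t"
  obtains u where "u \<in> p_integers p" "rat_pcong p p u 1"
    "(b - of_nat (p - 1)) * (b gchoose (p - 1)) = of_nat p * t * u"
proof -
  note closed = p_integers_closed[OF prime_p] and num = p_integers_numeral[OF prime_p]
    and nat = p_integers_of_nat[OF prime_p] and prod = p_integers_prod[OF prime_p]
  define u where "u = inverse (fact (p - 1)) * (\<Prod>j\<in>{0..<p}-{r}. b - of_nat j)"
  have p0: "p > 0" using prime_p prime_gt_0_nat by blast
  have b: "b \<in> p_integers p" unfolding b_def using assms by (intro closed nat)
  have f: "inverse (fact (p - 1)) \<in> p_integers p" using p_integers_inverse_fact[OF prime_p] p0 by simp
  \<comment> \<open>The residue of \<open>r - j\<close>; the summand \<open>p\<close> keeps the subtraction on \<^typ>\<open>nat\<close> exact.\<close>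
  define \<rho> where "\<rho> = (\<lambda>j. (r + p - j) mod p)"
  have cong: "rat_pcong p p (b - of_nat j) (of_nat (\<rho> j))" if "j < p" for j
  proof -
    have "r + p - j = p * ((r + p - j) div p) + \<rho> j" unfolding \<rho>_def by simp
    then have "of_nat (r + p - j) = (of_nat (p * ((r + p - j) div p) + \<rho> j) :: rat)" by simp
    then have "of_nat r + of_nat p - of_nat j
        = of_nat p * of_nat ((r + p - j) div p) + (of_nat (\<rho> j) :: rat)"
      using that by simp
    then have "b - of_nat j - of_nat (\<rho> j) = of_nat p * (t - 1 + of_nat ((r + p - j) div p))"
      unfolding b_def by (simp add: algebra_simps)
    moreover have "t - 1 + of_nat ((r + p - j) div p) \<in> p_integers p"
      using assms by (intro closed num nat)
    ultimately show ?thesis unfolding rat_pcong_def by blast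
  qed
  have inj: "inj_on \<rho> {0..<p}"
  proof (rule inj_onI)
    fix i j assume ij: "i \<in> {0..<p}" "j \<in> {0..<p}" "\<rho> i = \<rho> j"
    then have "int (r + p - i) mod int p = int (r + p - j) mod int p"
      unfolding \<rho>_def by (metis zmod_int)
    then have "int p dvd int (r + p - i) - int (r + p - j)" by (simp add: mod_eq_dvd_iff)
    then have "int p dvd int j - int i" using ij by (simp add: of_nat_diff)
    then show "i = j" using ij zdvd_imp_le[of "int p" "int j - int i"]
      zdvd_imp_le[of "int p" "int i - int j"] by (cases i j rule: linorder_cases)
       (auto simp: dvd_diff_commute)
  qed
  have "\<rho> ` {0..<p} = {0..<p}"
    using inj p0 by (intro card_subset_eq) (auto simp: card_image \<rho>_def)
  moreover have "\<rho> r = 0" unfolding \<rho>_def by simp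
  ultimately have im: "\<rho> ` ({0..<p} - {r}) = {1..p - 1}"
    using inj \<open>r < p\<close> by (subst inj_on_image_set_diff[OF inj]) auto
  have "(\<Prod>j\<in>{0..<p}-{r}. of_nat (\<rho> j)) = (\<Prod>i\<in>\<rho> ` ({0..<p}-{r}). of_nat i :: rat)"
    by (subst prod.reindex[OF inj_on_subset[OF inj]]) auto
  also have "\<dots> = fact (p - 1)" unfolding im fact_prod by simp
  finally have fact: "(\<Prod>j\<in>{0..<p}-{r}. of_nat (\<rho> j)) = (fact (p - 1) :: rat)" .
  have "rat_pcong p p u (inverse (fact (p - 1)) * (\<Prod>j\<in>{0..<p}-{r}. of_nat (\<rho> j)))"
    unfolding u_def
    by (intro rat_pcong_mult_left[OF prime_p] rat_pcong_prod[OF prime_p] f cong closed b nat) auto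
  then have "rat_pcong p p u 1" unfolding fact by simp
  moreover have "u \<in> p_integers p"
    unfolding u_def by (intro closed f prod b nat)
  moreover have "(b - of_nat (p - 1)) * (b gchoose (p - 1)) = of_nat p * t * u"
  proof -
    have "(b - of_nat (p - 1)) * (b gchoose (p - 1))
        = inverse (fact (p - 1)) * (\<Prod>j\<in>{0..<p}. b - of_nat j)"
      using gbinomial_complete_block[of b "p - 1"] p0 by simp
    also have "(\<Prod>j\<in>{0..<p}. b - of_nat j) = (b - of_nat r) * (\<Prod>j\<in>{0..<p}-{r}. b - of_nat j)"
      using \<open>r < p\<close> by (intro prod.remove) auto
    finally show ?thesis unfolding u_def b_def by simp
  qed
  ultimately show thesis using that by blast
qed

section \<open>The three-term recurrence\<close>

text \<open>All four terms are multiples of \<open>(a-m+1) \<dots> (a+m)\<close>.  With \<open>k = m + 1\<close>, what remains is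
  \<open>(a+1)(a+k)(a+k+1) - (2a+1)(a-k+1)(a+k) + a(a-k)(a-k+1) = 2(2a+1)k\<^sup>2\<close>.\<close>

lemma legendre_coeff_recurrence:
  fixes a :: "'a :: field_char_0"
  shows "(a + 1) * ((a + 1 gchoose Suc m) * (-1 - (a + 1) gchoose Suc m))
    - (2 * a + 1) * ((a gchoose Suc m) * (-1 - a gchoose Suc m))
    + a * ((a - 1 gchoose Suc m) * (-1 - (a - 1) gchoose Suc m))
    = - 2 * (2 * a + 1) * ((a gchoose m) * (-1 - a gchoose m))"
proof -
  define k where "k = (of_nat (Suc m) :: 'a)"
  define A where "A = (a gchoose m)"
  define B where "B = (-1 - a gchoose m)"
  have k0: "k \<noteq> 0" unfolding k_def by (simp del: of_nat_Suc)
  have m: "of_nat m = k - 1" unfolding k_def by simp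
  \<comment> \<open>All six binomials are expressed through \<open>A\<close> and \<open>B\<close>.  In the outer terms the
    prefactors \<open>a + 1\<close> and \<open>a\<close> are absorbed, so no division by them occurs.\<close>
  have step: "(c gchoose Suc m) = (c - k + 1) * (c gchoose m) / k" for c :: 'a
    using gbinomial_mult_1[of c m] k0 unfolding m k_def[symmetric] by (simp add: field_simps)
  have a1: "(a gchoose Suc m) = (a - k + 1) * A / k" unfolding A_def by (rule step)
  have b1: "(-1 - a gchoose Suc m) = (-1 - a - k + 1) * B / k" unfolding B_def by (rule step)
  have up: "(c + 1 gchoose Suc m) = (c + 1) * (c gchoose m) / k" for c :: 'a
    unfolding k_def by (simp add: gbinomial_factors)
  have a2: "(a + 1 gchoose Suc m) = (a + 1) * A / k" unfolding A_def by (rule up)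
  have b3: "(-1 - (a - 1) gchoose Suc m) = - a * B / k"
    unfolding B_def using up[of "-1 - a"] by simp
  have down: "c * (c - 1 gchoose Suc m) = (c - k) * (c gchoose Suc m)" for c :: 'a
    using gbinomial_absorb_comp[of c "Suc m"] unfolding k_def by simp
  have b2: "(a + 1) * (-1 - (a + 1) gchoose Suc m) = (a + 1 + k) * ((-1 - a - k + 1) * B / k)"
  proof -
    have shift: "-1 - (a + 1) = -1 - a - 1" by simp
    have "(a + 1) * (-1 - (a + 1) gchoose Suc m) = - ((-1 - a) * (-1 - a - 1 gchoose Suc m))"
      unfolding shift by (simp only: minus_mult_left minus_diff_eq) (simp add: add.commute)
    also have "\<dots> = - ((-1 - a - k) * ((-1 - a - k + 1) * B / k))" unfolding down b1 ..
    finally show ?thesis by (simp only: minus_mult_left) (simp add: add_ac)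
  qed
  have a3: "a * (a - 1 gchoose Suc m) = (a - k) * ((a - k + 1) * A / k)"
    using down[of a] unfolding a1 .
  have "(a + 1) * ((a + 1 gchoose Suc m) * (-1 - (a + 1) gchoose Suc m))
      = (a + 1) * A / k * ((a + 1) * (-1 - (a + 1) gchoose Suc m))"
    unfolding a2 by (simp only: mult_ac)
  also have "\<dots> = (a + 1) * A / k * ((a + 1 + k) * ((-1 - a - k + 1) * B / k))"
    unfolding b2 ..
  finally have 1: "(a + 1) * ((a + 1 gchoose Suc m) * (-1 - (a + 1) gchoose Suc m)) = \<dots>" .
  have "a * ((a - 1 gchoose Suc m) * (-1 - (a - 1) gchoose Suc m))
      = (a * (a - 1 gchoose Suc m)) * (-1 - (a - 1) gchoose Suc m)"
    by (simp only: mult_ac)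
  also have "\<dots> = (a - k) * ((a - k + 1) * A / k) * (- a * B / k)"
    unfolding a3 b3 ..
  finally have 2: "a * ((a - 1 gchoose Suc m) * (-1 - (a - 1) gchoose Suc m)) = \<dots>" .
  have "(a + 1) * A / k * ((a + 1 + k) * ((-1 - a - k + 1) * B / k))
      - (2 * a + 1) * ((a - k + 1) * A / k * ((-1 - a - k + 1) * B / k))
      + (a - k) * ((a - k + 1) * A / k) * (- a * B / k)
      = - 2 * (2 * a + 1) * (A * B)"
    using k0 by (simp add: field_simps)
  then show ?thesis unfolding 1 2 a1 b1 unfolding A_def B_def .
qed

text \<open>The polynomial \<open>[:1/2, -1/2:]\<close> is \<open>y = (1 - x)/2\<close>.  Because \<open>x = 1 - 2y\<close>, raising the degree
  of the truncation by one cancels the boundary term and creates the next one.\<close>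

lemma gen_legendre_recurrence_defect:
  "smult (a + 1) (gen_legendre n (a + 1)) - smult (2 * a + 1) ([:0, 1:] * gen_legendre n a)
    + smult a (gen_legendre n (a - 1))
    = smult (2 * (2 * a + 1) * ((a gchoose n) * (-1 - a gchoose n))) ([:1/2, -1/2:] ^ Suc n)"
proof (induction n)
  case 0
  then show ?case by (simp add: gen_legendre_def field_simps)
next
  case (Suc n)
  define c where "c = (\<lambda>b :: rat. (b gchoose Suc n) * (-1 - b gchoose Suc n))"
  define d where "d = (a gchoose n) * (-1 - a gchoose n)"
  define Z where "Z = ([:1/2, -1/2:] :: rat poly) ^ Suc n"
  have step: "gen_legendre (Suc n) b = gen_legendre n b + smult (c b) Z" for b
    unfolding gen_legendre_def c_def Z_def by (simp del: power_Suc)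
  have "[:0, 1:] = 1 - smult 2 ([:1/2, -1/2:] :: rat poly)" by (simp add: one_pCons)
  then have X: "[:0, 1:] * Z = Z - smult 2 ([:1/2, -1/2:] * Z)"
    by (simp only: left_diff_distrib mult_smult_left mult_1_left)
  have IH: "smult (a + 1) (gen_legendre n (a + 1)) - smult (2 * a + 1) ([:0, 1:] * gen_legendre n a)
    + smult a (gen_legendre n (a - 1)) = smult (2 * (2 * a + 1) * d) Z"
    using Suc.IH unfolding d_def Z_def .
  have rec: "(a + 1) * c (a + 1) - (2 * a + 1) * c a + a * c (a - 1) = - (2 * (2 * a + 1) * d)"
    using legendre_coeff_recurrence[of a n] unfolding c_def d_def
    by (simp only: mult_minus_left)
  have "smult (a + 1) (gen_legendre (Suc n) (a + 1))
      - smult (2 * a + 1) ([:0, 1:] * gen_legendre (Suc n) a)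
      + smult a (gen_legendre (Suc n) (a - 1))
    = (smult (a + 1) (gen_legendre n (a + 1)) - smult (2 * a + 1) ([:0, 1:] * gen_legendre n a)
      + smult a (gen_legendre n (a - 1)))
      + (smult (a + 1) (smult (c (a + 1)) Z) - smult (2 * a + 1) (smult (c a) ([:0, 1:] * Z))
      + smult a (smult (c (a - 1)) Z))"
    unfolding step distrib_left smult_add_right mult_smult_right by (simp only: algebra_simps)
  also have "smult (a + 1) (smult (c (a + 1)) Z) - smult (2 * a + 1) (smult (c a) ([:0, 1:] * Z))
      + smult a (smult (c (a - 1)) Z)
    = smult ((a + 1) * c (a + 1) - (2 * a + 1) * c a + a * c (a - 1)) Z
      + smult (2 * (2 * a + 1) * c a) ([:1/2, -1/2:] * Z)"
    unfolding X smult_diff_right smult_diff_left smult_add_left smult_smult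
    by (simp only: algebra_simps)
  finally show ?case unfolding IH rec
    by (simp only: smult_minus_left Z_def[symmetric] power_Suc[of _ "Suc n"] c_def)
qed

section \<open>The boundary coefficient modulo \<open>p\<^sup>3\<close>\<close>

context
  fixes p :: nat
  assumes prime_p: "prime p" and odd_p: "odd p"
begin

text \<open>Each of the two blocks contributes one multiple of \<open>p\<close>, so the cofactor matters only
  modulo \<open>p\<close>.\<close>

lemma boundary_coeff_generic:
  assumes t: "t \<in> p_integers p" and r: "0 < r" "r + 1 < p"
    and a: "a = of_nat r + of_nat p * t"
  shows "rat_pcong p (p ^ 3) ((2 * a + 1) * ((a gchoose (p - 1)) * (-1 - a gchoose (p - 1))))
    (of_nat p ^ 2 * (t * (1 + t)) * (1 / of_nat r + 1 / (of_nat r + 1)))"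
proof -
  note closed = p_integers_closed[OF prime_p] and num = p_integers_numeral[OF prime_p]
    and nat = p_integers_of_nat[OF prime_p]
  define b where "b = a + of_nat p - 1"
  define w where "w = a - of_nat (p - 1)"
  have az: "a \<in> p_integers p" and wz: "w \<in> p_integers p"
    unfolding w_def a by (intro closed nat t)+
  obtain u where u: "u \<in> p_integers p" "rat_pcong p p u 1"
    "w * (a gchoose (p - 1)) = of_nat p * t * u"
    using block_of_consecutive_factors[OF prime_p t, of r] r unfolding w_def a by auto
  \<comment> \<open>The block \<open>a+1, \<dots>, a+p-1\<close> together with \<open>a\<close> descends from \<open>b = a+p-1\<close>, whose residue is
    \<open>r - 1\<close>; the carry turns \<open>t\<close> into \<open>1 + t\<close>.\<close>
  have b: "b = of_nat (r - 1) + of_nat p * (1 + t)"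
    using r unfolding b_def a by (simp add: of_nat_diff algebra_simps)
  have "1 + t \<in> p_integers p" by (intro closed num t)
  moreover have "r - 1 < p" using r by simp
  ultimately obtain v where v: "v \<in> p_integers p" "rat_pcong p p v 1"
    "(b - of_nat (p - 1)) * (b gchoose (p - 1)) = of_nat p * (1 + t) * v"
    using block_of_consecutive_factors[OF prime_p, of "1 + t" "r - 1", folded b] by metis
  have bp: "b - of_nat (p - 1) = a" using r unfolding b_def by (simp add: of_nat_diff)
  have ev: "even (p - 1)" using odd_p by simp
  have neg: "(-1 - a gchoose (p - 1)) = (b gchoose (p - 1))"
    using gbinomial_minus[of "a + 1" "p - 1"] ev r
    unfolding b_def by (simp add: of_nat_diff algebra_simps)
  have ar: "rat_pcong p p a (of_nat r)"
    unfolding rat_pcong_def a using t by auto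
  have "w - of_nat (r + 1) = of_nat p * (t - 1)"
    using r unfolding w_def a by (simp add: of_nat_diff algebra_simps)
  moreover have "t - 1 \<in> p_integers p" by (intro closed t num)
  ultimately have wr: "rat_pcong p p w (of_nat (r + 1))" unfolding rat_pcong_def by blast
  have unit: "inverse (of_nat k) \<in> p_integers p \<and> inverse x \<in> p_integers p \<and> x \<noteq> 0
      \<and> rat_pcong p p (inverse x) (inverse (of_nat k))"
    if "0 < k" "k < p" "x \<in> p_integers p" "rat_pcong p p x (of_nat k)" for k x
  proof -
    have k: "\<not> p dvd k" using that by (simp add: nat_dvd_not_less)
    then have "\<not> rat_pcong p p x 0"
      using that rat_pcong_of_nat_0_iff[OF prime_p] rat_pcong_trans[OF prime_p]
        rat_pcong_sym[OF prime_p] by blast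
    moreover from this have "x \<noteq> 0" using rat_pcong_refl[OF prime_p] by auto
    ultimately show ?thesis
      using that k by (auto intro!: rat_pcong_inverse[OF prime_p] p_integers_inverse[OF prime_p]
          p_integers_inverse_of_nat[OF prime_p])
  qed
  note ua = unit[OF _ _ az ar] and uw = unit[OF _ _ wz wr]
  have ua': "inverse (of_nat r) \<in> p_integers p" "inverse a \<in> p_integers p" "a \<noteq> 0"
    "rat_pcong p p (inverse a) (inverse (of_nat r))" using ua r by auto
  have uw': "inverse (of_nat (r + 1)) \<in> p_integers p" "inverse w \<in> p_integers p" "w \<noteq> 0"
    "rat_pcong p p (inverse w) (inverse (of_nat (r + 1)))" using uw r by blast+
  have "rat_pcong p p ((2 * a + 1) * (u * v) * (inverse a * inverse w))
    ((2 * of_nat r + 1) * (1 * 1) * (inverse (of_nat r) * inverse (of_nat (r + 1))))"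
    by (intro rat_pcong_mult[OF prime_p] rat_pcong_add[OF prime_p] rat_pcong_refl[OF prime_p]
        closed num nat u v ua' uw' az ar)
  also have "(2 * of_nat r + 1) * (1 * 1) * (inverse (of_nat r) * inverse (of_nat (r + 1)))
      = 1 / of_nat r + 1 / (of_nat r + 1 :: rat)"
    using r by (simp add: field_simps add_eq_0_iff)
  finally have W: "rat_pcong p p ((2 * a + 1) * (u * v) * (inverse a * inverse w))
    (1 / of_nat r + 1 / (of_nat r + 1))" .
  have "a * w * ((a gchoose (p - 1)) * (-1 - a gchoose (p - 1)))
      = (w * (a gchoose (p - 1))) * ((b - of_nat (p - 1)) * (b gchoose (p - 1)))"
    unfolding neg bp by (simp only: mult_ac)
  also have "\<dots> = of_nat (p ^ 2) * (t * (1 + t)) * (u * v)"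
    unfolding u(3) v(3) by (simp add: power2_eq_square)
  finally have aw: "a * w * ((a gchoose (p - 1)) * (-1 - a gchoose (p - 1))) = \<dots>" .
  have "(2 * a + 1) * ((a gchoose (p - 1)) * (-1 - a gchoose (p - 1)))
    = (2 * a + 1) * (inverse a * inverse w)
      * (a * w * ((a gchoose (p - 1)) * (-1 - a gchoose (p - 1))))"
    using ua'(3) uw'(3) by (simp add: field_simps)
  also have "\<dots> = of_nat (p ^ 2) * ((t * (1 + t)) * ((2 * a + 1) * (u * v) * (inverse a * inverse w)))"
    unfolding aw by (simp only: mult_ac)
  finally have "(2 * a + 1) * ((a gchoose (p - 1)) * (-1 - a gchoose (p - 1))) = \<dots>" .
  moreover have "rat_pcong p (p ^ 2 * p)
    (of_nat (p ^ 2) * ((t * (1 + t)) * ((2 * a + 1) * (u * v) * (inverse a * inverse w))))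
    (of_nat (p ^ 2) * ((t * (1 + t)) * (1 / of_nat r + 1 / (of_nat r + 1))))"
    by (intro rat_pcong_scale_modulus[OF prime_p] rat_pcong_mult_left[OF prime_p] W closed t num)
  ultimately have "rat_pcong p (p ^ 2 * p)
    ((2 * a + 1) * ((a gchoose (p - 1)) * (-1 - a gchoose (p - 1))))
    (of_nat (p ^ 2) * ((t * (1 + t)) * (1 / of_nat r + 1 / (of_nat r + 1))))"
    by (simp only:)
  moreover have "p ^ 2 * p = p ^ 3" by (simp add: power3_eq_cube power2_eq_square)
  ultimately show ?thesis by (simp add: mult.assoc)
qed

text \<open>Pairing \<open>a - j\<close> with \<open>-a - j\<close> gives \<open>j\<^sup>2 (1 - a\<^sup>2/j\<^sup>2)\<close>, so the factors other than \<open>a\<close> are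
  known modulo \<open>p\<^sup>2\<close>.\<close>

lemma boundary_coeff_zero:
  assumes t: "t \<in> p_integers p" and a: "a = of_nat p * t"
  shows "rat_pcong p (p ^ 3) ((2 * a + 1) * ((a gchoose (p - 1)) * (-1 - a gchoose (p - 1))))
    (a * (of_nat p + a + 1))"
proof -
  note closed = p_integers_closed[OF prime_p] and num = p_integers_numeral[OF prime_p]
    and nat = p_integers_of_nat[OF prime_p]
  have p1: "p > 1" using prime_p prime_gt_1_nat by blast
  define w where "w = a - of_nat (p - 1)"
  define E where "E = (\<Prod>j\<in>{1..p-1}. 1 - a ^ 2 * inverse (of_nat j) ^ 2)"
  have az: "a \<in> p_integers p" and wz: "w \<in> p_integers p"
    unfolding w_def a by (intro closed nat t)+
  have inv: "inverse (of_nat j) \<in> p_integers p" if "j \<in> {1..p-1}" for j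
    using that by (intro p_integers_inverse_of_nat[OF prime_p]) (auto simp: nat_dvd_not_less)
  have factor: "1 - a ^ 2 * inverse (of_nat j) ^ 2 \<in> p_integers p" if "j \<in> {1..p-1}" for j
    unfolding power2_eq_square by (intro closed num az inv that)
  have Ez: "E \<in> p_integers p" unfolding E_def by (intro p_integers_prod[OF prime_p] factor)
  have "rat_pcong p (p ^ 2) (1 - a ^ 2 * inverse (of_nat j) ^ 2) 1" if "j \<in> {1..p-1}" for j
  proof -
    have "1 - a ^ 2 * inverse (of_nat j) ^ 2 - 1
        = of_nat (p ^ 2) * (- (t * t * (inverse (of_nat j) * inverse (of_nat j))))"
      unfolding a by (simp add: power2_eq_square)
    moreover have "- (t * t * (inverse (of_nat j) * inverse (of_nat j))) \<in> p_integers p"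
      by (intro closed t inv that)
    ultimately show ?thesis unfolding rat_pcong_def by blast
  qed
  then have "rat_pcong p (p ^ 2) E (\<Prod>j\<in>{1..p-1}. 1)"
    unfolding E_def by (intro rat_pcong_prod[OF prime_p] factor num) auto
  then have E1: "rat_pcong p (p ^ 2) E 1" by simp

  have A: "w * (a gchoose (p - 1)) = a * inverse (fact (p - 1)) * (\<Prod>j\<in>{1..p-1}. a - of_nat j)"
  proof -
    have "{0..p - 1} = insert 0 {1..p - 1}" by auto
    moreover have "{0..<p} = {0..p - 1}" using p1 by auto
    ultimately have "(\<Prod>j\<in>{0..<p}. a - of_nat j) = a * (\<Prod>j\<in>{1..p-1}. a - of_nat j)" by simp
    moreover have "w * (a gchoose (p - 1)) = inverse (fact (p - 1)) * (\<Prod>j\<in>{0..<p}. a - of_nat j)"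
      unfolding w_def using gbinomial_complete_block[of a "p - 1"] p1 by simp
    ultimately show ?thesis by simp
  qed
  have B: "(-1 - a gchoose (p - 1)) = inverse (fact (p - 1)) * (\<Prod>j\<in>{1..p-1}. - a - of_nat j)"
  proof -
    have "(\<Prod>j\<in>{0..<p-1}. -1 - a - of_nat j) = (\<Prod>j\<in>{1..p-1}. - a - of_nat j)"
      by (rule prod.reindex_bij_witness[of _ "\<lambda>j. j - 1" Suc]) auto
    then show ?thesis by (simp add: gbinomial_prod_rev field_simps)
  qed
  have "(\<Prod>j\<in>{1..p-1}. a - of_nat j) * (\<Prod>j\<in>{1..p-1}. - a - of_nat j)
      = (\<Prod>j\<in>{1..p-1}. of_nat j * of_nat j * (1 - a ^ 2 * inverse (of_nat j) ^ 2))"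
    unfolding prod.distrib[symmetric]
    by (intro prod.cong refl) (simp add: field_simps power2_eq_square)
  also have "\<dots> = fact (p - 1) * fact (p - 1) * E"
    unfolding E_def by (simp add: prod.distrib fact_prod)
  finally have pairs: "(\<Prod>j\<in>{1..p-1}. a - of_nat j) * (\<Prod>j\<in>{1..p-1}. - a - of_nat j) = \<dots>" .
  have "w * ((a gchoose (p - 1)) * (-1 - a gchoose (p - 1)))
      = (w * (a gchoose (p - 1))) * (-1 - a gchoose (p - 1))"
    by (simp only: mult.assoc)
  also have "\<dots> = a * inverse (fact (p - 1)) * inverse (fact (p - 1))
      * ((\<Prod>j\<in>{1..p-1}. a - of_nat j) * (\<Prod>j\<in>{1..p-1}. - a - of_nat j))"
    unfolding A B by (simp only: mult_ac)
  also have "\<dots> = a * E" unfolding pairs by (simp add: field_simps)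
  finally have "w * ((a gchoose (p - 1)) * (-1 - a gchoose (p - 1))) = a * E" .
  moreover have wr: "\<not> rat_pcong p p w 0"
  proof
    assume "rat_pcong p p w 0"
    moreover have "w - 1 = of_nat p * (t - 1)"
      using p1 unfolding w_def a by (simp add: of_nat_diff algebra_simps)
    moreover have "t - 1 \<in> p_integers p" by (intro closed t num)
    ultimately have "rat_pcong p p (of_nat 1) 0"
      using rat_pcong_trans[OF prime_p] rat_pcong_sym[OF prime_p] unfolding rat_pcong_def
      by (metis of_nat_1)
    then show False unfolding rat_pcong_of_nat_0_iff[OF prime_p] using p1 by simp
  qed
  moreover have w0: "w \<noteq> 0" using wr rat_pcong_refl[OF prime_p] by auto
  ultimately have c: "(2 * a + 1) * ((a gchoose (p - 1)) * (-1 - a gchoose (p - 1)))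
    = of_nat p * (t * (inverse w * ((2 * a + 1) * E)))"
    unfolding a by (simp add: field_simps)
  have wz': "inverse w \<in> p_integers p" by (intro p_integers_inverse[OF prime_p] wz wr)
  note [trans] = rat_pcong_trans[OF prime_p]
  have "rat_pcong p (p ^ 2) ((2 * a + 1) * E) ((2 * a + 1) * 1)"
    by (intro rat_pcong_mult_left[OF prime_p] E1 closed num az)
  \<comment> \<open>Indeed \<open>w (p+a+1) = (1+a)\<^sup>2 - p\<^sup>2\<close>, and \<open>p\<^sup>2\<close> divides \<open>a\<^sup>2\<close>.\<close>
  also have "rat_pcong p (p ^ 2) ((2 * a + 1) * 1) (w * (of_nat p + a + 1))"
  proof -
    have "(2 * a + 1) * 1 - w * (of_nat p + a + 1) = of_nat (p ^ 2) * (1 - t * t)"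
      using p1 unfolding w_def a by (simp add: of_nat_diff algebra_simps power2_eq_square)
    moreover have "1 - t * t \<in> p_integers p" by (intro closed t num)
    ultimately show ?thesis unfolding rat_pcong_def by blast
  qed
  finally have "rat_pcong p (p ^ 2) ((2 * a + 1) * E) (w * (of_nat p + a + 1))" .
  then have "rat_pcong p (p * p ^ 2) (of_nat p * (t * (inverse w * ((2 * a + 1) * E))))
     (of_nat p * (t * (inverse w * (w * (of_nat p + a + 1)))))"
    by (intro rat_pcong_scale_modulus[OF prime_p] rat_pcong_mult_left[OF prime_p] wz' t)
  moreover have "of_nat p * (t * (inverse w * (w * (of_nat p + a + 1)))) = a * (of_nat p + a + 1)"
    using w0 unfolding a by simp
  moreover have "p * p ^ 2 = p ^ 3" by (simp add: power3_eq_cube power2_eq_square)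
  ultimately show ?thesis unfolding c by (simp only:)
qed

lemma boundary_coeff_minus_one:
  assumes t: "t \<in> p_integers p" and a: "a = -1 + of_nat p * t"
  shows "rat_pcong p (p ^ 3) ((2 * a + 1) * ((a gchoose (p - 1)) * (-1 - a gchoose (p - 1))))
    (- (a + 1) * (a - of_nat p))"
proof -
  have m: "- t \<in> p_integers p" using p_integers_minus[OF prime_p t] .
  have eq: "(2 * (-1 - a) + 1) * ((-1 - a gchoose (p - 1)) * (-1 - (-1 - a) gchoose (p - 1)))
      = - ((2 * a + 1) * ((a gchoose (p - 1)) * (-1 - a gchoose (p - 1))))"
    by (simp add: algebra_simps)
  have "-1 - a = of_nat p * (- t)" unfolding a by simp
  then have "rat_pcong p (p ^ 3) (- ((2 * a + 1) * ((a gchoose (p - 1)) * (-1 - a gchoose (p - 1)))))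
     ((-1 - a) * (of_nat p + (-1 - a) + 1))"
    using boundary_coeff_zero[OF m, of "-1 - a"] unfolding eq by blast
  from rat_pcong_mult_left[OF prime_p this p_integers_of_int[OF prime_p, of "-1"]]
  have "rat_pcong p (p ^ 3) ((2 * a + 1) * ((a gchoose (p - 1)) * (-1 - a gchoose (p - 1))))
     (- ((-1 - a) * (of_nat p + (-1 - a) + 1)))" by simp
  moreover have "- ((-1 - a) * (of_nat p + (-1 - a) + 1)) = - (a + 1) * (a - of_nat p)"
    by (simp add: algebra_simps)
  ultimately show ?thesis by (simp only:)
qed

end

theorem theorem2p1:
  fixes p :: nat and a :: rat
  assumes "prime p" and "odd p" and "a \<in> p_integers p"
  shows "poly_pcong p (p ^ 3)
    (smult (a + 1) (gen_legendre (p - 1) (a + 1))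
      - smult (2 * a + 1) ([:0, 1:] * gen_legendre (p - 1) a)
      + smult a (gen_legendre (p - 1) (a - 1)))
    (if \<not> rat_pcong p p a 0 \<and> \<not> rat_pcong p p a (-1) then
       smult (- 2 * of_nat p ^ 2
              * (1 / of_nat (least_residue p a) + 1 / (of_nat (least_residue p a) + 1))
              * ((a - of_nat (least_residue p a)) / of_nat p)
              * (1 + (a - of_nat (least_residue p a)) / of_nat p))
         ([:-1/2, 1/2:] ^ p)
     else if rat_pcong p p a 0 then
       smult (- 2 * a * (of_nat p + a + 1)) ([:-1/2, 1/2:] ^ p)
     else
       smult (2 * (a + 1) * (a - of_nat p)) ([:-1/2, 1/2:] ^ p))"
proof -
  note prime_p = \<open>prime p\<close>
  have p0: "p > 0" using prime_p prime_gt_0_nat by blast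
  define s where "s = (2 * a + 1) * ((a gchoose (p - 1)) * (-1 - a gchoose (p - 1)))"
  have "([:1/2, -1/2:] :: rat poly) ^ p = (- [:-1/2, 1/2:]) ^ p" by simp
  also have "\<dots> = - ([:-1/2, 1/2:] ^ p)" using \<open>odd p\<close> by (rule power_minus_odd)
  finally have Y: "([:1/2, -1/2:] :: rat poly) ^ p = - ([:-1/2, 1/2:] ^ p)" .
  have lhs: "smult (a + 1) (gen_legendre (p - 1) (a + 1))
      - smult (2 * a + 1) ([:0, 1:] * gen_legendre (p - 1) a)
      + smult a (gen_legendre (p - 1) (a - 1)) = smult (-2 * s) ([:-1/2, 1/2:] ^ p)"
  proof -
    have "2 * (2 * a + 1) * ((a gchoose (p - 1)) * (-1 - a gchoose (p - 1))) = 2 * s"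
      unfolding s_def by (simp only: mult.assoc)
    moreover have "Suc (p - 1) = p" using p0 by simp
    ultimately show ?thesis
      unfolding gen_legendre_recurrence_defect by (simp only: Y smult_minus_right) simp
  qed
  have "\<not> p dvd 2"
    using \<open>odd p\<close> prime_p by (metis primes_dvd_imp_eq two_is_prime_nat even_numeral)
  then have half: "inverse (of_nat 2) \<in> p_integers p" by (rule p_integers_inverse_of_nat[OF prime_p])
  then have "coeff [:-1/2, 1/2:] i \<in> p_integers p" for i
    using p_integers_minus[OF prime_p half] p_integers_numeral[OF prime_p]
    by (auto simp: coeff_pCons inverse_eq_divide split: nat.split)
  then have Q: "coeff ([:-1/2, 1/2:] ^ p) i \<in> p_integers p" for i
    by (intro p_integers_coeff_power[OF prime_p])
  have main: "poly_pcong p (p ^ 3) (smult (-2 * s) ([:-1/2, 1/2:] ^ p))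
     (smult s' ([:-1/2, 1/2:] ^ p))" if "rat_pcong p (p ^ 3) s s''" "s' = -2 * s''" for s' s''
    using rat_pcong_mult_left[OF prime_p that(1) p_integers_of_int[OF prime_p, of "-2"]] that(2)
    by (intro poly_pcong_smult[OF prime_p _ Q]) simp
  show ?thesis
  proof (cases "rat_pcong p p a 0")
    case True
    then obtain t where "t \<in> p_integers p" "a = of_nat p * t" unfolding rat_pcong_def by auto
    then have "rat_pcong p (p ^ 3) s (a * (of_nat p + a + 1))"
      unfolding s_def by (rule boundary_coeff_zero[OF prime_p \<open>odd p\<close>])
    then have "poly_pcong p (p ^ 3) (smult (-2 * s) ([:-1/2, 1/2:] ^ p))
        (smult (- 2 * a * (of_nat p + a + 1)) ([:-1/2, 1/2:] ^ p))"
      by (rule main) simp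
    then show ?thesis unfolding lhs using True by simp
  next
    case not0: False
    show ?thesis
    proof (cases "rat_pcong p p a (-1)")
      case True
      then obtain t where t: "t \<in> p_integers p" "a - (-1) = of_nat p * t"
        unfolding rat_pcong_def by blast
      then have "a = -1 + of_nat p * t" by (simp add: algebra_simps)
      with t have "rat_pcong p (p ^ 3) s (- (a + 1) * (a - of_nat p))"
        unfolding s_def by (intro boundary_coeff_minus_one[OF prime_p \<open>odd p\<close>])
      then have "poly_pcong p (p ^ 3) (smult (-2 * s) ([:-1/2, 1/2:] ^ p))
          (smult (2 * (a + 1) * (a - of_nat p)) ([:-1/2, 1/2:] ^ p))"
        by (rule main) (simp add: algebra_simps)
      then show ?thesis unfolding lhs using True not0 by simp
    next
      case False
      define r where "r = least_residue p a"
      define t where "t = (a - of_nat r) / of_nat p"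
      have r: "r < p" "rat_pcong p p a (of_nat r)"
        unfolding r_def using least_residue[OF prime_p \<open>a \<in> p_integers p\<close>] by auto
      then have t: "t \<in> p_integers p" unfolding t_def rat_pcong_def using p0 by auto
      have a: "a = of_nat r + of_nat p * t" unfolding t_def using p0 by simp
      have "r \<noteq> 0" using r(2) not0 by (cases "r = 0") auto
      moreover have "r + 1 \<noteq> p"
      proof
        assume "r + 1 = p"
        then have "a - (-1) = of_nat p * (t + 1)" unfolding a by (auto simp: algebra_simps)
        moreover have "t + 1 \<in> p_integers p"
          by (intro p_integers_add[OF prime_p] t p_integers_numeral[OF prime_p])
        ultimately show False using False unfolding rat_pcong_def by blast
      qed
      ultimately have "rat_pcong p (p ^ 3) s
        (of_nat p ^ 2 * (t * (1 + t)) * (1 / of_nat r + 1 / (of_nat r + 1)))"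
        unfolding s_def using r(1) by (intro boundary_coeff_generic[OF prime_p \<open>odd p\<close> t _ _ a]) auto
      then have "poly_pcong p (p ^ 3) (smult (-2 * s) ([:-1/2, 1/2:] ^ p))
        (smult (- 2 * of_nat p ^ 2 * (1 / of_nat r + 1 / (of_nat r + 1)) * t * (1 + t))
          ([:-1/2, 1/2:] ^ p))"
        by (rule main) simp
      then show ?thesis unfolding lhs r_def[symmetric] t_def[symmetric] using not0 False by simp
    qed
  qed
qed

end
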